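(* Let $p\ge1$ be an integer, $h>0$ and $\omega\in\mathbb R\setminus\{0\}$. Let $\mathsf V=(V_{j,k}):\mathbb Z^2\to\mathbb C$ be discrete holomorphic with respect to $\mathsf Z$ and satisfy $$\mathcal L_p[\mathsf V_{*,k}]+\omega^2\mathsf V_{*,k}=0\qquad\text{for all }k\in\mathbb Z,$$ where $\mathsf V_{*,k}=(V_{j,k})_{j\in\mathbb Z}$. Let $\tilde{\mathsf v}=(\tilde v_j)_{j\in\mathbb Z}$ with $\tilde v_j=V_{0,j}$, and let $\hat\Phi^{(r)}_j,\hat\Psi^{(r)}_j$ be the associated auxiliary variables defined in the context. Then for all $j\in\mathbb Z$ and $r=1,\dots,p$, $$V_{-r,j}=\tilde v_{j-r}-h\sum_{\ell=1}^r\sigma_{j-\ell}\hat\Phi^{(r+1-\ell)}_{j-\ell},\qquad V_{r,j}=\tilde v_{j+r}+h\sum_{\ell=1}^r\sigma_{j+\ell-1}\hat\Psi^{(r+1-\ell)}_{j+\ell}.$$ Furthermore, $\tilde{\mathsf v}$, $\hat{\Phi}^{(r)}=(\hat\Phi^{(r)}_j)$ and $\hat{\Psi}^{(r)}=(\hat\Psi^{(r)}_j)$ satisfy, for all $j\in\mathbb Z$ and $r=1,\dots,p$, the system $$-\omega^2\tilde v_j=\mathcal L_p[\tilde{\mathsf v}]_j+h\sum_{r=1}^p\sum_{\ell=1}^r\left(a_r\sigma_{j+\ell-1}\hat\Psi^{(r+1-\ell)}_{j+\ell}-a_{-r}\sigma_{j-\ell}\hat\Phi^{(r+1-\ell)}_{j-\ell}\right),$$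 $$i\omega\hat\Phi^{(r)}_j=\frac{\tilde v_{j-r+2}-\tilde v_{j-r}}{2h}+\frac{\sigma_j\hat\Phi^{(r)}_j+\sigma_{j-1}\hat\Phi^{(r)}_{j-1}}{2}+\sum_{\ell=1}^{r-1}\frac{\sigma_{j-1-\ell}\hat\Phi^{(r-\ell)}_{j-1-\ell}-\sigma_{j+1-\ell}\hat\Phi^{(r-\ell)}_{j+1-\ell}}{2},$$ $$i\omega\hat\Psi^{(r)}_j=\frac{\tilde v_{j+r}-\tilde v_{j+r-2}}{2h}+\frac{\sigma_{j-1}\hat\Psi^{(r)}_j+\sigma_j\hat\Psi^{(r)}_{j+1}}{2}+\sum_{\ell=1}^{r-1}\frac{\sigma_{j+\ell}\hat\Psi^{(r-\ell)}_{j+\ell+1}-\sigma_{j+\ell-2}\hat\Psi^{(r-\ell)}_{j+\ell-1}}{2}.$$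
   Context: Finite difference operator. For $h>0$ and an integer $p\ge1$, $\{a_r\}_{r=-p}^p\subset\mathbb R$ are the coefficients of the centered symmetric finite difference approximation of the second derivative of optimal order $2p$ on the grid $x_j=jh$: $a_{-r}=a_r$ and $$\tfrac{a_0\delta_{n,0}}{2}+\sum_{r=1}^p (rh)^{2n}a_r=\delta_{n,1},\qquad n=0,\dots,p.$$ For $\mathsf v=(v_j)\in\mathbb C^{\mathbb Z}$, $\mathcal L_p[\mathsf v]_j:=\sum_{r=-p}^p a_r v_{j+r}$, $j\in\mathbb Z$. Damping coefficients and discrete complex domain. $(\sigma_j)_{j\in\mathbb Z}$ are real numbers with $\sigma_j\ge0$ for $j\ge0$ and $\sigma_j=0$ for $j<0$. The map $\mathsf Z=(Z_{j,k}):\mathbb Z^2\to\mathbb C$ is $$Z_{j,k}=(j+k)h+i\frac{h}{\omega}\sum_{\ell=0}^{k-1}\sigma_\ell,$$ where the sum is empty (zero) for $k\le 0$. Discrete holomorphicity. A function $\mathsf F=(F_{j,k}):\mathbb Z^2\to\mathbb C$ is discrete holomorphic with respect to $\mathsf Z$ if for all $(j,k)\in\mathbb Z^2$ the discrete Cauchy–Riemann equation $$\frac{F_{j+1,k+1}-F_{j,k}}{Z_{j+1,k+1}-Z_{j,k}}=\frac{F_{j,k+1}-F_{j+1,k}}{Z_{j,k+1}-Z_{j+1,k}}$$ holds, understood in cross-multiplied form, i.e. $(F_{j+1,k+1}-F_{j,k})(Z_{j,k+1}-Z_{j+1,k})=(F_{j,k+1}-F_{j+1,k})(Z_{j+1,k+1}-Z_{j,k})$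 (so that when $\sigma_k=0$ it reads $F_{j,k+1}=F_{j+1,k}$). Auxiliary variables. For $j\in\mathbb Z$ and $r=1,\dots,p$, $\hat\Phi^{(r)}_j$ and $\hat\Psi^{(r)}_j$ are defined by $$i\omega\hat\Phi^{(r)}_j=\frac{V_{-r+1,j+1}-V_{-r,j}}{2h+i\frac{\sigma_jh}{\omega}},\qquad i\omega\hat\Psi^{(r)}_j=\frac{V_{r,j}-V_{r-1,j-1}}{2h+i\frac{\sigma_{j-1}h}{\omega}}$$ (these are the discrete complex derivatives of $\mathsf V$ with respect to $\mathsf Z$ on the faces with lower-left vertices $(-r,j)$ and $(r-1,j-1)$, respectively). *)

theory Defs
  imports Complex_Main
begin

text \<open>
  Doubly infinite sequences are functions on \<^typ>\<open>int\<close> and grid functions on the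
  square lattice are curried functions \<open>F j k\<close> of two integers.
\<close>

text \<open>
  Only the values of \<open>a\<close> on \<open>{-p..p}\<close> are constrained. The symmetry
  reduces the order conditions to the even moments, in which the central coefficient
  contributes (with weight one half) for \<open>n = 0\<close> only.
\<close>
definition centered_fd_coeffs :: "nat \<Rightarrow> real \<Rightarrow> (int \<Rightarrow> real) \<Rightarrow> bool" where
  "centered_fd_coeffs p h a \<longleftrightarrow>
     (\<forall>r\<in>{- int p..int p}. a (- r) = a r) \<and>
     (\<forall>n\<le>p. (if n = 0 then a 0 / 2 else 0) + (\<Sum>r=1..p. (real r * h) ^ (2 * n) * a (int r))
              = (if n = 1 then 1 else 0))"

definition fd_op :: "nat \<Rightarrow> (int \<Rightarrow> real) \<Rightarrow> (int \<Rightarrow> complex) \<Rightarrow> int \<Rightarrow> complex" where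
  "fd_op p a v j = (\<Sum>r\<in>{- int p..int p}. of_real (a r) * v (j + r))"

definition damping_coeffs :: "(int \<Rightarrow> real) \<Rightarrow> bool" where
  "damping_coeffs \<sigma> \<longleftrightarrow> (\<forall>j\<ge>0. \<sigma> j \<ge> 0) \<and> (\<forall>j<0. \<sigma> j = 0)"

text \<open>The integer interval \<open>{0..k - 1}\<close> is empty for \<open>k \<le> 0\<close>.\<close>
definition complex_domain :: "real \<Rightarrow> real \<Rightarrow> (int \<Rightarrow> real) \<Rightarrow> int \<Rightarrow> int \<Rightarrow> complex" where
  "complex_domain h \<omega> \<sigma> j k =
     of_int (j + k) * of_real h + \<i> * of_real (h / \<omega>) * of_real (\<Sum>l\<in>{0..k - 1}. \<sigma> l)"

text \<open>
  The discrete Cauchy-Riemann equation in cross-multiplied form, so that it is meaningful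
  also on faces one of whose diagonals is mapped to zero by \<open>Z\<close>.
\<close>
definition discrete_holomorphic ::
    "(int \<Rightarrow> int \<Rightarrow> complex) \<Rightarrow> (int \<Rightarrow> int \<Rightarrow> complex) \<Rightarrow> bool" where
  "discrete_holomorphic Z F \<longleftrightarrow>
     (\<forall>j k. (F (j + 1) (k + 1) - F j k) * (Z j (k + 1) - Z (j + 1) k)
          = (F j (k + 1) - F (j + 1) k) * (Z (j + 1) (k + 1) - Z j k))"

end

theory Submission
  imports Defs
begin

text \<open>
  The two diagonals of the face with lower-left vertex \<open>(j, k)\<close> are mapped by the complex domain
  to \<open>2 h + \<i> \<sigma>\<^sub>k h / \<omega>\<close> and \<open>\<i> \<sigma>\<^sub>k h / \<omega>\<close>. The discrete Cauchy-Riemann equation says that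
  \<open>V\<close> has the same difference quotient along both. An auxiliary variable is, up to the factor
  \<open>\<i> \<omega>\<close>, this quotient along the long diagonal, which never degenerates because its real part is
  \<open>2 h\<close>. Reading the same quotient off the short diagonal, and using
  \<open>\<i> \<omega> \<cdot> \<i> \<sigma>\<^sub>k h / \<omega> = - h \<sigma>\<^sub>k\<close>, yields the jump of \<open>V\<close> across the short diagonal
  (\<open>discrete_holomorphic_short_diagonal\<close>): moving one step along an antidiagonal
  \<open>j + k = const\<close> of the lattice changes \<open>V\<close>, up to sign, by \<open>h\<close> times a damping
  coefficient times an auxiliary variable.

  Summing \<open>r\<close> such steps from the column \<open>j = 0\<close>, where \<open>V\<close> agrees with the restricted
  sequence \<open>v\<close>, reaches the columns \<open>r\<close> and \<open>-r\<close> and gives the two representation formulas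
  (\<open>antidiagonal_sum\<close>). Everything else is substitution. The first equation of the system is the
  discrete Helmholtz equation at the column \<open>0\<close>, the only place where the stencil reaches
  exactly the columns \<open>-p..p\<close>. The equations for the auxiliary variables are their defining
  equations with denominators cleared: the imaginary part of the long diagonal produces the term
  \<open>h \<sigma> \<Phi>\<close> (or \<open>h \<sigma> \<Psi>\<close>), and the two values of \<open>V\<close> are replaced by the representation formulas, whose
  sums are aligned term by term (\<open>antidiagonal_difference\<close>).
\<close>

section \<open>The diagonals of a face\<close>

text \<open>
  For \<open>k < 0\<close> both sums are empty, so this is where the vanishing of the damping at negative
  indices enters.
\<close>
lemma damping_partial_sum_Suc:
  assumes "damping_coeffs \<sigma>"
  shows "(\<Sum>l\<in>{0..k}. \<sigma> l) = (\<Sum>l\<in>{0..k - 1}. \<sigma> l) + \<sigma> k"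
proof (cases "k \<ge> 0")
  case True
  then have "{0..k} = insert k {0..k - 1}" by auto
  then show ?thesis by simp
next
  case False
  then show ?thesis using assms by (simp add: damping_coeffs_def)
qed

lemma complex_domain_short_diagonal:
  assumes "damping_coeffs \<sigma>"
  shows "complex_domain h \<omega> \<sigma> j (k + 1) - complex_domain h \<omega> \<sigma> (j + 1) k
    = \<i> * of_real (\<sigma> k * h / \<omega>)"
  by (simp add: complex_domain_def damping_partial_sum_Suc[OF assms, of k] algebra_simps)

lemma complex_domain_long_diagonal:
  assumes "damping_coeffs \<sigma>"
  shows "complex_domain h \<omega> \<sigma> (j + 1) (k + 1) - complex_domain h \<omega> \<sigma> j k
    = of_real (2 * h) + \<i> * of_real (\<sigma> k * h / \<omega>)"
  by (simp add: complex_domain_def damping_partial_sum_Suc[OF assms, of k] algebra_simps)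

lemma long_diagonal_nonzero:
  assumes "h > 0"
  shows "of_real (2 * h) + \<i> * of_real y \<noteq> (0 :: complex)"
  using assms by (simp add: complex_eq_iff)

text \<open>
  Clearing the denominator in the definition of an auxiliary variable \<open>X\<close>: the long diagonal
  contributes the real part \<open>2 h\<close> and, through its imaginary part, a damping term.
\<close>
lemma long_diagonal_difference:
  fixes D X :: complex
  assumes h: "h > 0" and \<omega>: "\<omega> \<noteq> 0"
    and X: "\<i> * of_real \<omega> * X = D / (of_real (2 * h) + \<i> * of_real (s * h / \<omega>))"
  shows "D = of_real (2 * h) * (\<i> * of_real \<omega> * X) - of_real h * (of_real s * X)"
proof -
  have "D = \<i> * of_real \<omega> * X * (of_real (2 * h) + \<i> * of_real (s * h / \<omega>))"
    by (rule sym) (rule iffD1[OF nonzero_eq_divide_eq[OF long_diagonal_nonzero[OF h]] X])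
  also have "\<dots> = of_real (2 * h) * (\<i> * of_real \<omega> * X)
      + (\<i> * \<i>) * (of_real \<omega> / of_real \<omega>) * (of_real s * of_real h * X)"
    by (simp add: algebra_simps)
  finally show ?thesis using \<omega> by simp
qed

text \<open>
  Equality of the two difference quotients determines the difference along the short diagonal
  also when \<open>\<sigma> k = 0\<close>, in which case both sides vanish.
\<close>
lemma discrete_holomorphic_short_diagonal:
  assumes h: "h > 0" and \<omega>: "\<omega> \<noteq> 0" and \<sigma>: "damping_coeffs \<sigma>"
    and hol: "discrete_holomorphic (complex_domain h \<omega> \<sigma>) V"
    and X: "\<i> * of_real \<omega> * X
      = (V (j + 1) (k + 1) - V j k) / (of_real (2 * h) + \<i> * of_real (\<sigma> k * h / \<omega>))"
  shows "V (j + 1) k - V j (k + 1) = of_real h * (of_real (\<sigma> k) * X)"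
proof -
  define L S where "L = complex_of_real (2 * h) + \<i> * of_real (\<sigma> k * h / \<omega>)"
    and "S = \<i> * complex_of_real (\<sigma> k * h / \<omega>)"
  have "L \<noteq> 0" unfolding L_def by (rule long_diagonal_nonzero[OF h])
  have "(V (j + 1) (k + 1) - V j k) * S = (V j (k + 1) - V (j + 1) k) * L"
    using hol unfolding discrete_holomorphic_def L_def S_def
    by (simp only: complex_domain_short_diagonal[OF \<sigma>] complex_domain_long_diagonal[OF \<sigma>])
  then have "V j (k + 1) - V (j + 1) k = \<i> * of_real \<omega> * X * S"
    using \<open>L \<noteq> 0\<close> unfolding X[folded L_def] by (simp add: nonzero_eq_divide_eq)
  also have "\<dots> = - (of_real h * (of_real (\<sigma> k) * X))"
  proof -
    have "\<i> * of_real \<omega> * X * S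
        = (\<i> * \<i>) * (of_real \<omega> / of_real \<omega>) * (of_real h * (of_real (\<sigma> k) * X))"
      unfolding S_def by (simp add: algebra_simps)
    then show ?thesis using \<omega> by simp
  qed
  finally show ?thesis by (simp add: algebra_simps)
qed

section \<open>Summation along antidiagonals\<close>

text \<open>
  The two half-planes are treated at once: \<open>W r k\<close> stands for \<open>V\<close> at distance \<open>r\<close> from the
  column \<open>0\<close>, the sign \<open>s\<close> is the direction in which the second index moves when the column
  \<open>0\<close> is approached (\<open>1\<close> on the right, \<open>-1\<close> on the left), and \<open>g\<close> is the increment of one step.
\<close>
lemma antidiagonal_sum:
  fixes W g :: "nat \<Rightarrow> int \<Rightarrow> 'a :: comm_monoid_add"
  assumes step: "\<And>r j. r < p \<Longrightarrow> W (Suc r) j = W r (j + s) + g (Suc r) j"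
    and "r \<le> p"
  shows "W r j = W 0 (j + s * int r) + (\<Sum>l=1..r. g (r + 1 - l) (j + s * (int l - 1)))"
  using \<open>r \<le> p\<close>
proof (induction r arbitrary: j)
  case 0
  show ?case by simp
next
  case (Suc r)
  have "(\<Sum>l=1..Suc r. g (Suc r + 1 - l) (j + s * (int l - 1)))
      = g (Suc r) j + (\<Sum>l=Suc 1..Suc r. g (Suc r + 1 - l) (j + s * (int l - 1)))"
    by (subst sum.atLeast_Suc_atMost) simp_all
  also have "(\<Sum>l=Suc 1..Suc r. g (Suc r + 1 - l) (j + s * (int l - 1)))
      = (\<Sum>l=1..r. g (r + 1 - l) (j + s + s * (int l - 1)))"
    by (subst sum.shift_bounds_cl_Suc_ivl) (simp add: algebra_simps)
  finally show ?case
    using step[of r j] Suc.IH[of "j + s"] Suc.prems by (simp add: algebra_simps)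
qed

text \<open>
  The endpoints of a long diagonal lie on neighbouring columns, so their representations have
  \<open>r\<close> and \<open>r - 1\<close> terms. Removing the first term of the longer sum aligns the superscripts of the
  remaining ones.
\<close>
lemma antidiagonal_difference:
  fixes W g :: "nat \<Rightarrow> int \<Rightarrow> 'a :: ab_group_add"
  assumes step: "\<And>r j. r < p \<Longrightarrow> W (Suc r) j = W r (j + s) + g (Suc r) j"
    and r: "r \<in> {1..p}"
  shows "W r j - W (r - 1) (j - s) = W 0 (j + s * int r) - W 0 (j + s * (int r - 2)) + g r j
    + (\<Sum>l=1..r - 1. g (r - l) (j + s * int l) - g (r - l) (j + s * (int l - 2)))"
proof -
  obtain q where q: "r = Suc q" "q < p" using r by (cases r) auto
  have "W q (j + s) = W 0 (j + s + s * int q) + (\<Sum>l=1..q. g (q + 1 - l) (j + s + s * (int l - 1)))"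
    by (rule antidiagonal_sum[where p = p and W = W and g = g and s = s, OF step]) (use q in auto)
  moreover have "W q (j - s)
      = W 0 (j - s + s * int q) + (\<Sum>l=1..q. g (q + 1 - l) (j - s + s * (int l - 1)))"
    by (rule antidiagonal_sum[where p = p and W = W and g = g and s = s, OF step]) (use q in auto)
  ultimately show ?thesis
    using step[OF q(2), of j] q(1) by (simp add: algebra_simps sum_subtractf)
qed

section \<open>The stencil folded at its centre\<close>

lemma fd_op_fold:
  "fd_op p a u j = of_real (a 0) * u j
    + (\<Sum>r=1..p. of_real (a (int r)) * u (j + int r) + of_real (a (- int r)) * u (j - int r))"
proof -
  have split: "{- int p..int p} = insert 0 (int ` {1..p} \<union> (\<lambda>r. - int r) ` {1..p})"
  proof (intro equalityI subsetI)
    fix x assume x: "x \<in> {- int p..int p}"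
    consider "x = 0" | "x > 0" | "x < 0" by linarith
    then show "x \<in> insert 0 (int ` {1..p} \<union> (\<lambda>r. - int r) ` {1..p})"
    proof cases
      case 2
      then have "x = int (nat x)" "nat x \<in> {1..p}" using x by auto
      then show ?thesis by blast
    next
      case 3
      then have "x = - int (nat (- x))" "nat (- x) \<in> {1..p}" using x by auto
      then show ?thesis by blast
    qed simp
  qed auto
  have inj: "inj_on int {1..p}" "inj_on (\<lambda>r. - int r) {1..p}" by (auto simp: inj_on_def)
  have "(\<Sum>r\<in>int ` {1..p} \<union> (\<lambda>r. - int r) ` {1..p}. of_real (a r) * u (j + r))
      = (\<Sum>r\<in>int ` {1..p}. of_real (a r) * u (j + r))
        + (\<Sum>r\<in>(\<lambda>r. - int r) ` {1..p}. of_real (a r) * u (j + r))"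
    by (rule sum.union_disjoint) auto
  moreover have "0 \<notin> int ` {1..p} \<union> (\<lambda>r. - int r) ` {1..p}" by auto
  ultimately show ?thesis
    unfolding fd_op_def split
    by (simp add: sum.reindex[OF inj(1)] sum.reindex[OF inj(2)] sum.distrib
        del: Un_iff One_nat_def)
qed

section \<open>Restriction of the discrete holomorphic extension\<close>

theorem proposition4p1:
  fixes p :: nat and h \<omega> :: real and a \<sigma> :: "int \<Rightarrow> real"
    and V :: "int \<Rightarrow> int \<Rightarrow> complex" and v :: "int \<Rightarrow> complex"
    and \<Phi> \<Psi> :: "nat \<Rightarrow> int \<Rightarrow> complex"
  assumes p: "p \<ge> 1" and h: "h > 0" and \<omega>: "\<omega> \<noteq> 0"
    and a: "centered_fd_coeffs p h a"
    and \<sigma>: "damping_coeffs \<sigma>"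
    and hol: "discrete_holomorphic (complex_domain h \<omega> \<sigma>) V"
    and helmholtz: "\<forall>k j. fd_op p a (\<lambda>i. V i k) j + of_real (\<omega>\<^sup>2) * V j k = 0"
    and v: "\<forall>j. v j = V 0 j"
    and \<Phi>: "\<forall>j. \<forall>r\<in>{1..p}. \<i> * of_real \<omega> * \<Phi> r j =
        (V (- int r + 1) (j + 1) - V (- int r) j) / (of_real (2 * h) + \<i> * of_real (\<sigma> j * h / \<omega>))"
    and \<Psi>: "\<forall>j. \<forall>r\<in>{1..p}. \<i> * of_real \<omega> * \<Psi> r j =
        (V (int r) j - V (int r - 1) (j - 1)) / (of_real (2 * h) + \<i> * of_real (\<sigma> (j - 1) * h / \<omega>))"
  shows
    "(\<forall>j. \<forall>r\<in>{1..p}.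
        V (- int r) j = v (j - int r)
          - of_real h * (\<Sum>l=1..r. of_real (\<sigma> (j - int l)) * \<Phi> (r + 1 - l) (j - int l))
      \<and> V (int r) j = v (j + int r)
          + of_real h * (\<Sum>l=1..r. of_real (\<sigma> (j + int l - 1)) * \<Psi> (r + 1 - l) (j + int l)))
   \<and> (\<forall>j. - of_real (\<omega>\<^sup>2) * v j = fd_op p a v j
          + of_real h * (\<Sum>r=1..p. \<Sum>l=1..r.
                of_real (a (int r) * \<sigma> (j + int l - 1)) * \<Psi> (r + 1 - l) (j + int l)
              - of_real (a (- int r) * \<sigma> (j - int l)) * \<Phi> (r + 1 - l) (j - int l)))
   \<and> (\<forall>j. \<forall>r\<in>{1..p}. \<i> * of_real \<omega> * \<Phi> r j =
          (v (j - int r + 2) - v (j - int r)) / of_real (2 * h)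
          + (of_real (\<sigma> j) * \<Phi> r j + of_real (\<sigma> (j - 1)) * \<Phi> r (j - 1)) / 2
          + (\<Sum>l=1..r - 1. (of_real (\<sigma> (j - 1 - int l)) * \<Phi> (r - l) (j - 1 - int l)
                          - of_real (\<sigma> (j + 1 - int l)) * \<Phi> (r - l) (j + 1 - int l)) / 2))
   \<and> (\<forall>j. \<forall>r\<in>{1..p}. \<i> * of_real \<omega> * \<Psi> r j =
          (v (j + int r) - v (j + int r - 2)) / of_real (2 * h)
          + (of_real (\<sigma> (j - 1)) * \<Psi> r j + of_real (\<sigma> j) * \<Psi> r (j + 1)) / 2
          + (\<Sum>l=1..r - 1. (of_real (\<sigma> (j + int l)) * \<Psi> (r - l) (j + int l + 1)
                          - of_real (\<sigma> (j + int l - 2)) * \<Psi> (r - l) (j + int l - 1)) / 2))"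
proof -
  \<comment> \<open>The outer endpoints \<open>(-r, j)\<close> and \<open>(r, j)\<close> of a step lie on the short diagonals of the faces
    with lower-left vertices \<open>(-r, j - 1)\<close> and \<open>(r - 1, j)\<close>, whose auxiliary variables are
    \<open>\<Phi> r (j - 1)\<close> and \<open>\<Psi> r (j + 1)\<close>.\<close>
  define WL gL WR gR :: "nat \<Rightarrow> int \<Rightarrow> complex"
    where "WL = (\<lambda>r. V (- int r))"
      and "gL = (\<lambda>r j. - (of_real h * (of_real (\<sigma> (j - 1)) * \<Phi> r (j - 1))))"
      and "WR = (\<lambda>r. V (int r))"
      and "gR = (\<lambda>r j. of_real h * (of_real (\<sigma> j) * \<Psi> r (j + 1)))"
  have stepL: "WL (Suc r) j = WL r (j + - 1) + gL (Suc r) j" if "r < p" for r j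
    using discrete_holomorphic_short_diagonal[OF h \<omega> \<sigma> hol,
        of "\<Phi> (Suc r) (j - 1)" "- int (Suc r)" "j - 1"] \<Phi>[rule_format, of "Suc r" "j - 1"] that
    by (simp add: WL_def gL_def algebra_simps)
  have stepR: "WR (Suc r) j = WR r (j + 1) + gR (Suc r) j" if "r < p" for r j
    using discrete_holomorphic_short_diagonal[OF h \<omega> \<sigma> hol,
        of "\<Psi> (Suc r) (j + 1)" "int r" j] \<Psi>[rule_format, of "Suc r" "j + 1"] that
    by (simp add: WR_def gR_def algebra_simps)
  have reprL: "V (- int r) j = v (j - int r)
      - of_real h * (\<Sum>l=1..r. of_real (\<sigma> (j - int l)) * \<Phi> (r + 1 - l) (j - int l))"
    if "r \<le> p" for r j
    using antidiagonal_sum[where W = WL and g = gL and s = "- 1", OF stepL that, of j] v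
    by (simp add: WL_def gL_def sum_negf sum_distrib_left)
  have reprR: "V (int r) j = v (j + int r)
      + of_real h * (\<Sum>l=1..r. of_real (\<sigma> (j + int l - 1)) * \<Psi> (r + 1 - l) (j + int l))"
    if "r \<le> p" for r j
    using antidiagonal_sum[where W = WR and g = gR and s = 1, OF stepR that, of j] v
    by (simp add: WR_def gR_def sum_distrib_left algebra_simps)

  have eq_v: "- of_real (\<omega>\<^sup>2) * v j = fd_op p a v j
      + of_real h * (\<Sum>r=1..p. \<Sum>l=1..r.
          of_real (a (int r) * \<sigma> (j + int l - 1)) * \<Psi> (r + 1 - l) (j + int l)
        - of_real (a (- int r) * \<sigma> (j - int l)) * \<Phi> (r + 1 - l) (j - int l))" for j
  proof -
    have stencil_pair: "of_real (a (int r)) * V (int r) j + of_real (a (- int r)) * V (- int r) j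
        = of_real (a (int r)) * v (j + int r) + of_real (a (- int r)) * v (j - int r)
          + of_real h * (\<Sum>l=1..r.
              of_real (a (int r) * \<sigma> (j + int l - 1)) * \<Psi> (r + 1 - l) (j + int l)
            - of_real (a (- int r) * \<sigma> (j - int l)) * \<Phi> (r + 1 - l) (j - int l))"
      if "r \<in> {1..p}" for r
      using that by (simp add: reprL reprR sum_subtractf sum_distrib_left algebra_simps)
    have "- of_real (\<omega>\<^sup>2) * v j = fd_op p a (\<lambda>i. V i j) 0"
      using helmholtz[rule_format, of j 0] v by (simp add: add_eq_0_iff)
    also have "\<dots> = of_real (a 0) * v j
        + (\<Sum>r=1..p. of_real (a (int r)) * V (int r) j + of_real (a (- int r)) * V (- int r) j)"
      using v by (simp add: fd_op_fold)
    also have "\<dots> = fd_op p a v j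
      + of_real h * (\<Sum>r=1..p. \<Sum>l=1..r.
          of_real (a (int r) * \<sigma> (j + int l - 1)) * \<Psi> (r + 1 - l) (j + int l)
        - of_real (a (- int r) * \<sigma> (j - int l)) * \<Phi> (r + 1 - l) (j - int l))"
      by (simp only: fd_op_fold[of p a v] stencil_pair sum.distrib sum_distrib_left add.assoc
          cong: sum.cong)
    finally show ?thesis .
  qed

  have solve: "x = d / of_real (2 * h) + s / 2 + t / 2"
    if "of_real (2 * h) * x = d + of_real h * s + of_real h * t" for x d s t :: complex
    using that h by (simp add: field_simps)

  have eq_\<Phi>: "\<i> * of_real \<omega> * \<Phi> r j =
      (v (j - int r + 2) - v (j - int r)) / of_real (2 * h)
      + (of_real (\<sigma> j) * \<Phi> r j + of_real (\<sigma> (j - 1)) * \<Phi> r (j - 1)) / 2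
      + (\<Sum>l=1..r - 1. (of_real (\<sigma> (j - 1 - int l)) * \<Phi> (r - l) (j - 1 - int l)
                      - of_real (\<sigma> (j + 1 - int l)) * \<Phi> (r - l) (j + 1 - int l)) / 2)"
    if r: "r \<in> {1..p}" for r j
  proof -
    define T where "T = (\<Sum>l=1..r - 1. of_real (\<sigma> (j - 1 - int l)) * \<Phi> (r - l) (j - 1 - int l)
                      - of_real (\<sigma> (j + 1 - int l)) * \<Phi> (r - l) (j + 1 - int l))"
    have diff: "V (- int r) j - V (- int r + 1) (j + 1) = v (j - int r) - v (j - int r + 2)
        - of_real h * (of_real (\<sigma> (j - 1)) * \<Phi> r (j - 1)) - of_real h * T"
      using antidiagonal_difference[where W = WL and g = gL and s = "- 1", OF stepL r, of j] v r
      by (simp add: WL_def gL_def T_def sum_distrib_left sum_subtractf sum_negf of_nat_diff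
          algebra_simps)
    have "of_real (2 * h) * (\<i> * of_real \<omega> * \<Phi> r j)
        = - (V (- int r) j - V (- int r + 1) (j + 1)) + of_real h * (of_real (\<sigma> j) * \<Phi> r j)"
      using long_diagonal_difference[OF h \<omega> \<Phi>[rule_format, OF r, of j]]
      by (simp add: algebra_simps)
    then have "of_real (2 * h) * (\<i> * of_real \<omega> * \<Phi> r j)
        = (v (j - int r + 2) - v (j - int r))
          + of_real h * (of_real (\<sigma> j) * \<Phi> r j + of_real (\<sigma> (j - 1)) * \<Phi> r (j - 1))
          + of_real h * T"
      unfolding diff by (simp add: algebra_simps)
    from solve[OF this] show ?thesis unfolding T_def sum_divide_distrib .
  qed

  have eq_\<Psi>: "\<i> * of_real \<omega> * \<Psi> r j =
      (v (j + int r) - v (j + int r - 2)) / of_real (2 * h)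
      + (of_real (\<sigma> (j - 1)) * \<Psi> r j + of_real (\<sigma> j) * \<Psi> r (j + 1)) / 2
      + (\<Sum>l=1..r - 1. (of_real (\<sigma> (j + int l)) * \<Psi> (r - l) (j + int l + 1)
                      - of_real (\<sigma> (j + int l - 2)) * \<Psi> (r - l) (j + int l - 1)) / 2)"
    if r: "r \<in> {1..p}" for r j
  proof -
    define T where "T = (\<Sum>l=1..r - 1. of_real (\<sigma> (j + int l)) * \<Psi> (r - l) (j + int l + 1)
                      - of_real (\<sigma> (j + int l - 2)) * \<Psi> (r - l) (j + int l - 1))"
    have diff: "V (int r) j - V (int r - 1) (j - 1) = v (j + int r) - v (j + int r - 2)
        + of_real h * (of_real (\<sigma> j) * \<Psi> r (j + 1)) + of_real h * T"
      using antidiagonal_difference[where W = WR and g = gR and s = 1, OF stepR r, of j] v r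
      by (simp add: WR_def gR_def T_def sum_distrib_left sum_subtractf of_nat_diff algebra_simps)
    have "of_real (2 * h) * (\<i> * of_real \<omega> * \<Psi> r j)
        = V (int r) j - V (int r - 1) (j - 1) + of_real h * (of_real (\<sigma> (j - 1)) * \<Psi> r j)"
      using long_diagonal_difference[OF h \<omega> \<Psi>[rule_format, OF r, of j]]
      by (simp add: algebra_simps)
    then have "of_real (2 * h) * (\<i> * of_real \<omega> * \<Psi> r j)
        = (v (j + int r) - v (j + int r - 2))
          + of_real h * (of_real (\<sigma> (j - 1)) * \<Psi> r j + of_real (\<sigma> j) * \<Psi> r (j + 1))
          + of_real h * T"
      unfolding diff by (simp add: algebra_simps)
    from solve[OF this] show ?thesis unfolding T_def sum_divide_distrib .
  qed

  show ?thesis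
    using reprL reprR eq_v eq_\<Phi> eq_\<Psi> by (intro conjI allI ballI) (simp_all only: atLeastAtMost_iff)
qed

end
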